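(* Let $\upsilon\ge1$ be an integer, $p>1$ and $q>-1$ real, $t,w$ real, and let $\beta$ be a complex number that is not a non-positive integer. Then, as formal power series in $x$, $$\sum_{s=0}^{\infty}\frac{\Gamma(\beta+s)}{\Gamma(p+s)}\;{}_KN_{s;\upsilon}^{(p+2s,q)}(t,w)\,\frac{x^s}{s!}=(1-tx)^{-\beta}\;\mathcal S\!\left(\frac{-x}{1-tx},\,\frac{-txw^{\upsilon}}{1-tx}\right),$$ where $\mathcal S$ is the double hypergeometric series $$\mathcal S(X,Y)=\sum_{m=0}^{\infty}\sum_{r=0}^{\infty}\frac{\Gamma(\beta+m+r)}{\Gamma(p+m)\,\Gamma(q+1+\upsilon r)}\,\frac{X^m}{m!}\,\frac{Y^r}{r!}.$$
   Context: $(a)_n$ is the Pochhammer symbol. The first set of finite bivariate biorthogonal N-Konhauser polynomials is, for $q>-1$ and integers $0\le s<\frac{P-1}{2}$, $${}_KN_{s;\upsilon}^{(P,q)}(t,w)=\Gamma(P-s)\sum_{k=0}^{s}\sum_{m=0}^{s-k}\frac{(-s)_{k+m}\,t^{s-k}w^{\upsilon m}}{\Gamma(P-2s+k)\,\Gamma(q+1+\upsilon m)\,k!\,m!}.$$ With $P=p+2s$ the condition $s<\frac{P-1}{2}$ is $p>1$. The series $\mathcal S$ is the Srivastava–Daoust double series $S^{1:0;0}_{0:1;1}$ with parameters $[\beta:1,1]$, $[p:1]$, $[q+1;\upsilon]$. *)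

theory Defs
  imports "HOL-Analysis.Analysis"
begin

unbundle no vec_syntax
unbundle fps_syntax

definition KN :: "nat \<Rightarrow> nat \<Rightarrow> real \<Rightarrow> real \<Rightarrow> real \<Rightarrow> real \<Rightarrow> real" where
  "KN s \<upsilon> P q t w =
     Gamma (P - real s) *
     (\<Sum>k=0..s. \<Sum>m=0..s-k.
        pochhammer (- real s) (k + m) * t ^ (s - k) * w ^ (\<upsilon> * m) /
        (Gamma (P - 2 * real s + real k) * Gamma (q + 1 + real (\<upsilon> * m)) * fact k * fact m))"

definition SD_coeff :: "complex \<Rightarrow> real \<Rightarrow> real \<Rightarrow> nat \<Rightarrow> nat \<Rightarrow> nat \<Rightarrow> complex" where
  "SD_coeff \<beta> p q \<upsilon> m r =
     Gamma (\<beta> + of_nat (m + r)) /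
     (of_real (Gamma (p + real m)) * of_real (Gamma (q + 1 + real (\<upsilon> * r))) * fact m * fact r)"

text \<open>
  The infinite sums are limits in the metric of formal power series, i.e. coefficientwise
  eventually constant limits. They converge if \<^term>\<open>X\<close> and \<^term>\<open>Y\<close> have no constant term; see
  the lemmas below.
\<close>

definition SD_series ::
    "complex \<Rightarrow> real \<Rightarrow> real \<Rightarrow> nat \<Rightarrow> complex fps \<Rightarrow> complex fps \<Rightarrow> complex fps" where
  "SD_series \<beta> p q \<upsilon> X Y = (\<Sum>m. \<Sum>r. fps_const (SD_coeff \<beta> p q \<upsilon> m r) * X ^ m * Y ^ r)"

lemma fps_sums_if_low_coeffs_zero:
  fixes f :: "nat \<Rightarrow> complex fps"
  assumes "\<And>k n. n < k \<Longrightarrow> f k $ n = 0"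
  shows "f sums Abs_fps (\<lambda>n. \<Sum>k\<le>n. f k $ n)"
  unfolding sums_def tendsto_fps_iff
proof
  fix n
  have "(\<Sum>i<N. f i) $ n = (\<Sum>k\<le>n. f k $ n)" if "N \<ge> Suc n" for N
    unfolding fps_sum_nth using that assms
    by (intro sum.mono_neutral_right) auto
  then show "\<forall>\<^sub>F N in sequentially.
      (\<Sum>i<N. f i) $ n = Abs_fps (\<lambda>n. \<Sum>k\<le>n. f k $ n) $ n"
    unfolding eventually_sequentially by auto
qed

context
  fixes X Y :: "complex fps"
  assumes X0: "X $ 0 = 0" and Y0: "Y $ 0 = 0"
begin

lemma SD_term_nth_eq_0:
  assumes "n < m \<or> n < r"
  shows "(fps_const c * X ^ m * Y ^ r) $ n = 0"
proof -
  have "X ^ m $ i = 0" if "i < m" for i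
    using that X0 by (rule startsby_zero_power_prefix[rule_format, rotated])
  moreover have "Y ^ r $ i = 0" if "i < r" for i
    using that Y0 by (rule startsby_zero_power_prefix[rule_format, rotated])
  ultimately have "(X ^ m * Y ^ r) $ n = 0"
    using assms unfolding fps_mult_nth by (intro sum.neutral) auto
  then show ?thesis by (simp add: mult.assoc)
qed

lemma SD_inner_sums:
  "(\<lambda>r. fps_const (SD_coeff \<beta> p q \<upsilon> m r) * X ^ m * Y ^ r) sums
     Abs_fps (\<lambda>n. \<Sum>r\<le>n. (fps_const (SD_coeff \<beta> p q \<upsilon> m r) * X ^ m * Y ^ r) $ n)"
  by (intro fps_sums_if_low_coeffs_zero SD_term_nth_eq_0) simp

lemma SD_series_sums:
  "(\<lambda>m. \<Sum>r. fps_const (SD_coeff \<beta> p q \<upsilon> m r) * X ^ m * Y ^ r) sums SD_series \<beta> p q \<upsilon> X Y"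
proof -
  have "summable (\<lambda>m. \<Sum>r. fps_const (SD_coeff \<beta> p q \<upsilon> m r) * X ^ m * Y ^ r)"
    unfolding sums_unique[OF SD_inner_sums, symmetric]
    by (intro sums_summable[OF fps_sums_if_low_coeffs_zero])
       (simp add: SD_term_nth_eq_0 del: fps_mult_left_const_nth)
  then show ?thesis unfolding SD_series_def by (rule summable_sums)
qed

end

end

theory Submission
  imports Defs
begin

text \<open>
  Both sides are compared coefficient by coefficient. Write \<open>(1 - t x)\<^sup>-\<^sup>a\<close> for the binomial series
  with coefficients \<open>(a)\<^sub>n t\<^sup>n / n!\<close>. Multiplying the series for \<open>a = \<beta>\<close> by the term of \<open>\<S>\<close> with
  index \<open>(m, r)\<close> collects the denominators: the product is a multiple of
  \<open>x\<^sup>m\<^sup>+\<^sup>r (1 - t x)\<^sup>-\<^sup>\<beta>\<^sup>-\<^sup>m\<^sup>-\<^sup>r\<close>, whose coefficient at \<open>x\<^sup>s\<close> is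
  \<open>(\<beta> + m + r)\<^bsub>s-m-r\<^esub> t\<^bsup>s-m-r\<^esup> / (s - m - r)!\<close> if \<open>m + r \<le> s\<close>, and \<open>0\<close> otherwise
  (lemma \<open>binomial_series_times_SD_term_nth\<close>). The Pochhammer symbol merges with the factor
  \<open>\<Gamma>(\<beta> + m + r)\<close> of the term to \<open>\<Gamma>(\<beta> + s)\<close>, which no longer depends on \<open>m\<close> and \<open>r\<close>. What
  remains is the double sum defining the polynomial, because
  \<open>(-s)\<^bsub>m+r\<^esub> = (-1)\<^bsup>m+r\<^esup> s! / (s - m - r)!\<close>.

  Only finitely many terms of \<open>\<S>\<close> contribute to a given coefficient (lemma
  \<open>mult_SD_series_nth\<close>), so the infinite sums never have to be interchanged with the product.
\<close>

text \<open>The expansion of \<open>(1 - c x)\<^sup>-\<^sup>a\<close>.\<close>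

definition binomial_series :: "'a::field_char_0 \<Rightarrow> 'a \<Rightarrow> 'a fps" where
  "binomial_series c a = Abs_fps (\<lambda>n. pochhammer a n / fact n * c ^ n)"

lemma fps_binomial_compose_linear:
  "fps_binomial (- a) oo (- fps_const c * fps_X) = binomial_series c a"
proof (rule fps_ext)
  fix n
  have "- fps_const c * fps_X = fps_const (- c) * fps_X"
    by simp
  then show "(fps_binomial (- a) oo (- fps_const c * fps_X)) $ n = binomial_series c a $ n"
    by (simp add: binomial_series_def gbinomial_pochhammer power_minus[of c])
qed

text \<open>
  Up to the factor \<open>c\<^sup>n\<^sup>+\<^sup>1 / (n + 1)!\<close>, comparing coefficients at \<open>x\<^sup>n\<^sup>+\<^sup>1\<close> amounts to
  \<open>(a + 1)\<^sub>n\<^sub>+\<^sub>1 - (n + 1) (a + 1)\<^sub>n = (a + 1)\<^sub>n ((a + n + 1) - (n + 1)) = a (a + 1)\<^sub>n = (a)\<^sub>n\<^sub>+\<^sub>1\<close>.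
\<close>

lemma binomial_series_Suc_exponent:
  "(1 - fps_const c * fps_X) * binomial_series c (a + 1) = binomial_series c a"
proof (rule fps_ext)
  fix n
  show "((1 - fps_const c * fps_X) * binomial_series c (a + 1)) $ n = binomial_series c a $ n"
  proof (cases n)
    case 0
    then show ?thesis by (simp add: binomial_series_def)
  next
    case (Suc k)
    have "pochhammer a (Suc k) = pochhammer (a + 1) (Suc k) - of_nat (Suc k) * pochhammer (a + 1) k"
      unfolding pochhammer_rec[of a] pochhammer_Suc[of "a + 1"] by (simp add: algebra_simps)
    moreover have "(1 - fps_const c * fps_X) * B = B - fps_const c * (fps_X * B)" for B :: "'a fps"
      by (simp add: algebra_simps)
    ultimately show ?thesis
      by (simp add: Suc binomial_series_def divide_simps del: pochhammer_Suc of_nat_Suc)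
         (simp add: algebra_simps)
  qed
qed

lemma binomial_series_times_inverse_power:
  "binomial_series c a * inverse (1 - fps_const c * fps_X) ^ j = binomial_series c (a + of_nat j)"
proof (induction j arbitrary: a)
  case (Suc j)
  let ?D = "1 - fps_const c * fps_X"
  have "?D * inverse ?D = 1"
    by (rule inverse_mult_eq_1') simp
  then have "binomial_series c a * inverse ?D = binomial_series c (a + 1)"
    by (simp add: binomial_series_Suc_exponent[of c a, symmetric] mult_ac)
  then show ?case
    using Suc.IH[of "a + 1"] by (simp add: mult.assoc[symmetric] add.assoc)
qed simp

text \<open>
  The bound \<open>N\<close> may exceed \<open>n\<close> so that one truncation of the double series serves all coefficients
  up to \<open>N\<close> simultaneously; a Cauchy product needs all of them.
\<close>

lemma SD_series_nth:
  assumes "X $ 0 = 0" and "Y $ 0 = 0" and "n \<le> N"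
  shows "SD_series \<beta> p q \<upsilon> X Y $ n =
    (\<Sum>m\<le>N. \<Sum>r\<le>N. fps_const (SD_coeff \<beta> p q \<upsilon> m r) * X ^ m * Y ^ r) $ n"
proof -
  define T where "T m r = fps_const (SD_coeff \<beta> p q \<upsilon> m r) * X ^ m * Y ^ r" for m r
  have zero: "T m r $ i = 0" if "i < m \<or> i < r" for m r i
    unfolding T_def by (rule SD_term_nth_eq_0[OF assms(1,2) that])
  have inner: "(\<Sum>r. T m r) = Abs_fps (\<lambda>n. \<Sum>r\<le>n. T m r $ n)" for m
    unfolding T_def by (rule sums_unique[OF SD_inner_sums[OF assms(1,2)], symmetric])
  have "(\<lambda>m. \<Sum>r. T m r) sums Abs_fps (\<lambda>n. \<Sum>m\<le>n. (\<Sum>r. T m r) $ n)"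
    by (rule fps_sums_if_low_coeffs_zero) (simp add: inner zero)
  then have "SD_series \<beta> p q \<upsilon> X Y = Abs_fps (\<lambda>n. \<Sum>m\<le>n. (\<Sum>r. T m r) $ n)"
    unfolding SD_series_def T_def by (rule sums_unique[symmetric])
  then have "SD_series \<beta> p q \<upsilon> X Y $ n = (\<Sum>m\<le>n. \<Sum>r\<le>n. T m r $ n)"
    by (simp add: inner)
  also have "\<dots> = (\<Sum>m\<le>n. \<Sum>r\<le>N. T m r $ n)"
    using assms(3) by (intro sum.cong refl sum.mono_neutral_left) (auto simp: zero)
  also have "\<dots> = (\<Sum>m\<le>N. \<Sum>r\<le>N. T m r $ n)"
    using assms(3) by (intro sum.mono_neutral_left) (auto simp: zero)
  finally show ?thesis
    by (simp add: fps_sum_nth T_def)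
qed

lemma mult_SD_series_nth:
  assumes "X $ 0 = 0" and "Y $ 0 = 0"
  shows "(A * SD_series \<beta> p q \<upsilon> X Y) $ n =
    (\<Sum>m\<le>n. \<Sum>r\<le>n. (A * (fps_const (SD_coeff \<beta> p q \<upsilon> m r) * X ^ m * Y ^ r)) $ n)"
proof -
  let ?S = "\<Sum>m\<le>n. \<Sum>r\<le>n. fps_const (SD_coeff \<beta> p q \<upsilon> m r) * X ^ m * Y ^ r"
  have "(A * SD_series \<beta> p q \<upsilon> X Y) $ n = (A * ?S) $ n"
    unfolding fps_mult_nth
    by (intro sum.cong refl arg_cong2[where f = "(*)"] SD_series_nth[OF assms]) simp
  also have "A * ?S = (\<Sum>m\<le>n. \<Sum>r\<le>n. A * (fps_const (SD_coeff \<beta> p q \<upsilon> m r) * X ^ m * Y ^ r))"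
    by (simp add: sum_distrib_left)
  finally show ?thesis
    by (simp add: fps_sum_nth)
qed

text \<open>
  Every factor \<open>X\<close> or \<open>Y\<close> brings one \<open>x\<close> and one denominator \<open>1 - c x\<close>. The powers of \<open>x\<close> shift the
  coefficients by \<open>m + r\<close>, and each denominator raises the parameter of the binomial series by one.
\<close>

lemma binomial_series_times_SD_term_nth:
  fixes c d e \<beta> :: complex
  defines "D \<equiv> 1 - fps_const c * fps_X"
  shows "(binomial_series c \<beta> * (fps_const e * (- fps_X / D) ^ m * (- fps_const d * fps_X / D) ^ r)) $ n =
    (if m + r \<le> n
     then e * (- 1) ^ (m + r) * d ^ r * pochhammer (\<beta> + of_nat (m + r)) (n - (m + r))
          / fact (n - (m + r)) * c ^ (n - (m + r))
     else 0)"
proof -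
  have div: "f / D = f * inverse D" for f
    by (rule fps_divide_unit) (simp add: D_def)
  have "- fps_X / D = fps_const (- 1) * fps_X * inverse D"
    "- fps_const d * fps_X / D = fps_const (- d) * fps_X * inverse D"
    by (simp_all add: div fps_const_neg[symmetric] del: fps_const_neg)
  then have "binomial_series c \<beta> * (fps_const e * (- fps_X / D) ^ m * (- fps_const d * fps_X / D) ^ r)
    = fps_const (e * (- 1) ^ m * (- d) ^ r) * (fps_X ^ (m + r) * (binomial_series c \<beta> * inverse D ^ (m + r)))"
    by (simp only: power_mult_distrib fps_const_power power_add fps_const_mult[symmetric] mult_ac)
  also have "binomial_series c \<beta> * inverse D ^ (m + r) = binomial_series c (\<beta> + of_nat (m + r))"
    unfolding D_def by (rule binomial_series_times_inverse_power)
  finally show ?thesis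
    by (simp add: fps_X_power_mult_nth binomial_series_def power_minus[of d] power_add[of "- 1"]
        del: of_nat_add)
qed

lemma Gamma_mult_pochhammer:
  fixes z :: complex
  assumes "z \<notin> \<int>\<^sub>\<le>\<^sub>0"
  shows "Gamma (z + of_nat j) * pochhammer (z + of_nat j) k = Gamma (z + of_nat (j + k))"
proof -
  have "z + of_nat j \<notin> \<int>\<^sub>\<le>\<^sub>0"
    using assms by (metis add_diff_cancel_right' nonpos_Ints_diff_Nats of_nat_in_Nats)
  then show ?thesis
    by (simp add: pochhammer_Gamma Gamma_eq_zero_iff add.assoc)
qed

lemma pochhammer_neg_of_nat:
  assumes "j \<le> s"
  shows "pochhammer (- of_nat s) j = ((- 1) ^ j * fact s / fact (s - j) :: 'a::field_char_0)"
proof -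
  have "of_nat (s choose j) = (- 1) ^ j * pochhammer (- of_nat s) j / (fact j :: 'a)"
    by (simp add: binomial_gbinomial gbinomial_pochhammer)
  then show ?thesis
    using assms by (simp add: binomial_fact field_simps)
qed

text \<open>
  For \<open>P = p + 2 s\<close> the first Gamma factor in the summands is \<open>\<Gamma>(p + m)\<close>, free of \<open>s\<close>, as in \<open>\<S>\<close>.
  Summing over a square instead of the triangle \<open>m + r \<le> s\<close> matches the truncations of \<open>\<S>\<close>.
\<close>

lemma KN_shifted_parameter:
  "KN s \<upsilon> (p + 2 * real s) q t w = Gamma (p + real s) * fact s *
    (\<Sum>m\<le>s. \<Sum>r\<le>s. if m + r \<le> s
      then (- 1) ^ (m + r) * t ^ (s - m) * w ^ (\<upsilon> * r) /
           (fact (s - (m + r)) * Gamma (p + real m) * Gamma (q + 1 + real (\<upsilon> * r)) * fact m * fact r)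
      else 0)"
proof -
  let ?h = "\<lambda>m r. (- 1) ^ (m + r) * t ^ (s - m) * w ^ (\<upsilon> * r) /
    (fact (s - (m + r)) * Gamma (p + real m) * Gamma (q + 1 + real (\<upsilon> * r)) * fact m * fact r)"
  have "(\<Sum>r=0..s-m. pochhammer (- real s) (m + r) * t ^ (s - m) * w ^ (\<upsilon> * r) /
          (Gamma (p + real m) * Gamma (q + 1 + real (\<upsilon> * r)) * fact m * fact r))
      = fact s * (\<Sum>r\<le>s. if m + r \<le> s then ?h m r else 0)" if "m \<le> s" for m
  proof -
    have "(\<Sum>r\<le>s. if m + r \<le> s then ?h m r else 0) = (\<Sum>r=0..s-m. ?h m r)"
      using that by (intro sum.mono_neutral_cong_right) auto
    then show ?thesis
      using that by (simp add: sum_distrib_left pochhammer_neg_of_nat mult_ac)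
  qed
  then show ?thesis
    by (simp add: KN_def atLeast0AtMost sum_distrib_left mult.assoc add.commute[of p])
qed

theorem theorem20:
  fixes \<upsilon> :: nat and p q t w :: real and \<beta> :: complex
  assumes "\<upsilon> \<ge> 1" and "p > 1" and "q > -1" and "\<beta> \<notin> \<int>\<^sub>\<le>\<^sub>0"
  shows "Abs_fps (\<lambda>s. Gamma (\<beta> + of_nat s) / of_real (Gamma (p + real s))
                     * of_real (KN s \<upsilon> (p + 2 * real s) q t w) / fact s)
       = (fps_binomial (- \<beta>) oo (- fps_const (of_real t) * fps_X))
         * SD_series \<beta> p q \<upsilon>
             (- fps_X / (1 - fps_const (of_real t) * fps_X))
             (- fps_const (of_real (t * w ^ \<upsilon>)) * fps_X / (1 - fps_const (of_real t) * fps_X))"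
    (is "?L = (fps_binomial (- \<beta>) oo _) * SD_series \<beta> p q \<upsilon> ?X ?Y")
proof (rule fps_ext)
  fix s
  let ?h = "\<lambda>m r. (- 1) ^ (m + r) * t ^ (s - m) * w ^ (\<upsilon> * r) /
    (fact (s - (m + r)) * Gamma (p + real m) * Gamma (q + 1 + real (\<upsilon> * r)) * fact m * fact r)"
  have "Gamma (p + real s) > 0"
    using assms(2) by (intro Gamma_real_pos) simp
  then have "?L $ s = Gamma (\<beta> + of_nat s) *
      of_real (\<Sum>m\<le>s. \<Sum>r\<le>s. if m + r \<le> s then ?h m r else 0)"
    by (simp add: KN_shifted_parameter)
  also have "\<dots> = (\<Sum>m\<le>s. \<Sum>r\<le>s. if m + r \<le> s then Gamma (\<beta> + of_nat s) * of_real (?h m r) else 0)"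
    unfolding of_real_sum sum_distrib_left by (intro sum.cong refl) simp
  also have "\<dots> = (\<Sum>m\<le>s. \<Sum>r\<le>s.
      (binomial_series (of_real t) \<beta> * (fps_const (SD_coeff \<beta> p q \<upsilon> m r) * ?X ^ m * ?Y ^ r)) $ s)"
  proof (intro sum.cong refl)
    fix m r
    show "(if m + r \<le> s then Gamma (\<beta> + of_nat s) * of_real (?h m r) else 0) =
      (binomial_series (of_real t) \<beta> * (fps_const (SD_coeff \<beta> p q \<upsilon> m r) * ?X ^ m * ?Y ^ r)) $ s"
    proof (cases "m + r \<le> s")
      case True
      have "Gamma (\<beta> + of_nat s) =
          Gamma (\<beta> + of_nat (m + r)) * pochhammer (\<beta> + of_nat (m + r)) (s - (m + r))"
        using Gamma_mult_pochhammer[OF assms(4), of "m + r" "s - (m + r)"] True by simp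
      \<comment> \<open>\<open>t\<^sup>r\<close> comes from the second argument of \<open>\<S>\<close>, the rest from the binomial series\<close>
      moreover have "t ^ (s - m) = t ^ r * t ^ (s - (m + r))"
        using True by (simp flip: power_add)
      ultimately show ?thesis
        using True unfolding binomial_series_times_SD_term_nth
        by (simp add: SD_coeff_def power_mult_distrib power_mult mult_ac del: of_nat_add)
    next
      case False
      then show ?thesis
        unfolding binomial_series_times_SD_term_nth by simp
    qed
  qed
  also have "\<dots> = ((fps_binomial (- \<beta>) oo (- fps_const (of_real t) * fps_X))
      * SD_series \<beta> p q \<upsilon> ?X ?Y) $ s"
    unfolding fps_binomial_compose_linear
    by (rule mult_SD_series_nth[symmetric]) (simp_all add: fps_divide_unit)
  finally show "?L $ s = ((fps_binomial (- \<beta>) oo (- fps_const (of_real t) * fps_X))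
      * SD_series \<beta> p q \<upsilon> ?X ?Y) $ s" .
qed

end
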